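(* Let $D$ be a finite generalized digroup, fix a bar-unit $\xi\in\mathrm{Halo}(D)$, and identify $D\simeq G\times E$ with $G=G_l^{\xi}$ and $E=\mathrm{Halo}(D)$ by the structure isomorphism recalled in the context. For each $g\in G$, let $a_i(g):=c_i(c_g)$ and $b_j(g):=c_j(\rho(g))$ be the numbers of $i$-cycles of $c_g$ and of $j$-cycles of $\rho(g)$, respectively. Then, for every $(g,\alpha)\in G\times E$, the number of $\ell$-cycles of the left translation $L_{(g,\alpha)}$ of $\mathrm{Conj}(D)$ is $$c_\ell\bigl(L_{(g,\alpha)}\bigr)=\sum_{\substack{i,j\ge1\\ \mathrm{lcm}(i,j)=\ell}}a_i(g)\,b_j(g)\gcd(i,j).$$ Consequently, $$Z^{\mathrm{LT}}_{\mathrm{Conj}(D)}(u_1,u_2,\ldots)=\frac1{|G|}\sum_{g\in G}\ \prod_{\ell\ge1}u_\ell^{\ \sum_{i,j\ge1,\ \mathrm{lcm}(i,j)=\ell}a_i(g)b_j(g)\gcd(i,j)}.$$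
   Context: A generalized digroup is a nonempty set $D$ with two associative binary operations $\vdash,\dashv$ satisfying $x\vdash(y\dashv z)=(x\vdash y)\dashv z$, $x\dashv(y\dashv z)=x\dashv(y\vdash z)$, $(x\vdash y)\vdash z=(x\dashv y)\vdash z$, such that there is at least one bar-unit (an element $\xi$ with $x\dashv\xi=x=\xi\vdash x$ for all $x\in D$), and for every bar-unit $\xi$ and every $x\in D$ there are $x^{-1}_{r,\xi},x^{-1}_{l,\xi}\in D$ with $x\vdash x^{-1}_{r,\xi}=\xi$ and $x^{-1}_{l,\xi}\dashv x=\xi$. $\mathrm{Halo}(D)$ is the set of bar-units. Structure isomorphism (known): fix a bar-unit $\xi$. Let $G:=G_l^\xi=\{\xi\dashv x\mid x\in D\}$, the left group associated with $\xi$; it is a group under $\dashv$ with identity $\xi$ (law written multiplicatively). Let $E:=\mathrm{Halo}(D)$, a left $G$-set via $g\bullet\alpha:=g\vdash\alpha\dashv g^{-1}$ ($g^{-1}$ the inverse in $G$). Then $G\times E$ with $(g,\alpha)\vdash(h,\beta)=(gh,g\bullet\beta)$ and $(g,\alpha)\dashv(h,\beta)=(gh,\alpha)$ is a generalized digroup, and $x\mapsto(\xi\dashv x,\ x\dashv x^{-1}_{l,\xi})$ is an isomorphism $D\to G\times E$, used to identify them. A rack is a nonempty set $X$ with a binary operation $\triangleright$ such that each left translation $L_x(y)=x\triangleright y$ is bijective and $x\triangleright(y\triangleright z)=(x\triangleright y)\triangleright(x\triangleright z)$. The conjugation rack $\mathrm{Conj}(D)$ is the set $D$ with $x\triangleright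 y:=(x\vdash y)\dashv x^{-1}$, where $x^{-1}$ is any one-sided inverse of $x$ (right for $\vdash$ or left for $\dashv$) relative to a bar-unit; this is independent of the choice. Notation: $\rho:G\to\mathrm{Sym}(E)$, $\rho(g)(\beta)=g\bullet\beta$; $c_g:G\to G$, $c_g(h)=ghg^{-1}$. For a permutation $\sigma$ of a finite set, $c_\ell(\sigma)$ is the number of cycles of length $\ell$ in its cycle decomposition (fixed points are cycles of length $1$). For a finite rack $X$, the left-translation cycle index is $$Z_X^{\mathrm{LT}}(u_1,u_2,\ldots):=\frac1{|X|}\sum_{x\in X}\prod_{\ell\ge1}u_\ell^{\,c_\ell(L_x)}.$$ *)

theory Defs
  imports Complex_Main "HOL-Algebra.Group" "HOL-Combinatorics.Orbits" "HOL-Library.Poly_Mapping"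
begin

section \<open>Generalized digroups\<close>

record 'a digroup = "'a partial_object" +
  vdash :: "'a \<Rightarrow> 'a \<Rightarrow> 'a" (infixl "\<turnstile>\<index>" 70)
  dashv :: "'a \<Rightarrow> 'a \<Rightarrow> 'a" (infixl "\<stileturn>\<index>" 70)

definition Halo :: "('a, 'm) digroup_scheme \<Rightarrow> 'a set" where
  "Halo D = {e \<in> carrier D. \<forall>x\<in>carrier D. x \<stileturn>\<^bsub>D\<^esub> e = x \<and> e \<turnstile>\<^bsub>D\<^esub> x = x}"

locale generalized_digroup =
  fixes D :: "('a, 'm) digroup_scheme" (structure)
  assumes vdash_closed: "x \<in> carrier D \<Longrightarrow> y \<in> carrier D \<Longrightarrow> x \<turnstile> y \<in> carrier D"
    and dashv_closed: "x \<in> carrier D \<Longrightarrow> y \<in> carrier D \<Longrightarrow> x \<stileturn> y \<in> carrier D"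
    and vdash_assoc: "x \<in> carrier D \<Longrightarrow> y \<in> carrier D \<Longrightarrow> z \<in> carrier D \<Longrightarrow>
      (x \<turnstile> y) \<turnstile> z = x \<turnstile> (y \<turnstile> z)"
    and dashv_assoc: "x \<in> carrier D \<Longrightarrow> y \<in> carrier D \<Longrightarrow> z \<in> carrier D \<Longrightarrow>
      (x \<stileturn> y) \<stileturn> z = x \<stileturn> (y \<stileturn> z)"
    and vdash_dashv_assoc: "x \<in> carrier D \<Longrightarrow> y \<in> carrier D \<Longrightarrow> z \<in> carrier D \<Longrightarrow>
      x \<turnstile> (y \<stileturn> z) = (x \<turnstile> y) \<stileturn> z"
    and dashv_inner: "x \<in> carrier D \<Longrightarrow> y \<in> carrier D \<Longrightarrow> z \<in> carrier D \<Longrightarrow>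
      x \<stileturn> (y \<stileturn> z) = x \<stileturn> (y \<turnstile> z)"
    and vdash_inner: "x \<in> carrier D \<Longrightarrow> y \<in> carrier D \<Longrightarrow> z \<in> carrier D \<Longrightarrow>
      (x \<turnstile> y) \<turnstile> z = (x \<stileturn> y) \<turnstile> z"
    and Halo_nonempty: "Halo D \<noteq> {}"
    and right_inverse_exists: "\<xi> \<in> Halo D \<Longrightarrow> x \<in> carrier D \<Longrightarrow> \<exists>r\<in>carrier D. x \<turnstile> r = \<xi>"
    and left_inverse_exists: "\<xi> \<in> Halo D \<Longrightarrow> x \<in> carrier D \<Longrightarrow> \<exists>l\<in>carrier D. l \<stileturn> x = \<xi>"

definition one_sided_inverses :: "('a, 'm) digroup_scheme \<Rightarrow> 'a \<Rightarrow> 'a set" where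
  "one_sided_inverses D x =
    {y \<in> carrier D. x \<turnstile>\<^bsub>D\<^esub> y \<in> Halo D \<or> y \<stileturn>\<^bsub>D\<^esub> x \<in> Halo D}"

context generalized_digroup
begin

lemma HaloD:
  assumes "e \<in> Halo D"
  shows "e \<in> carrier D" "\<And>x. x \<in> carrier D \<Longrightarrow> x \<stileturn> e = x" "\<And>x. x \<in> carrier D \<Longrightarrow> e \<turnstile> x = x"
  using assms by (auto simp: Halo_def)

lemma one_sided_inverse_cancel:
  assumes x: "x \<in> carrier D" and y: "y \<in> one_sided_inverses D x" and w: "w \<in> carrier D"
  shows "(w \<stileturn> x) \<stileturn> y = w" "(w \<stileturn> y) \<stileturn> x = w" "x \<turnstile> (y \<turnstile> w) = w" "y \<turnstile> (x \<turnstile> w) = w"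
proof -
  obtain \<xi> where xi: "\<xi> \<in> Halo D" using Halo_nonempty by auto
  obtain r where r: "r \<in> carrier D" "x \<turnstile> r = \<xi>" using right_inverse_exists xi x by blast
  obtain l where l: "l \<in> carrier D" "l \<stileturn> x = \<xi>" using left_inverse_exists xi x by blast
  have R: "(v \<stileturn> x) \<stileturn> z = v" "x \<turnstile> (z \<turnstile> v) = v"
    if "v \<in> carrier D" "z \<in> carrier D" "x \<turnstile> z \<in> Halo D" for v z
    using that x by (simp_all add: dashv_assoc dashv_inner HaloD flip: vdash_assoc)
  have L: "(v \<stileturn> z) \<stileturn> x = v" "z \<turnstile> (x \<turnstile> v) = v"
    if "v \<in> carrier D" "z \<in> carrier D" "z \<stileturn> x \<in> Halo D" for v z
    using that x by (simp_all add: dashv_assoc HaloD vdash_inner flip: vdash_assoc)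
  have yc: "y \<in> carrier D" and cases: "x \<turnstile> y \<in> Halo D \<or> y \<stileturn> x \<in> Halo D"
    using y by (auto simp: one_sided_inverses_def)
  have "(w \<stileturn> x) \<stileturn> y = w \<and> (w \<stileturn> y) \<stileturn> x = w \<and> x \<turnstile> (y \<turnstile> w) = w \<and> y \<turnstile> (x \<turnstile> w) = w"
    using cases
  proof
    assume h: "x \<turnstile> y \<in> Halo D"
    have "(w \<stileturn> y) \<stileturn> x = w"
      using R(1)[OF _ yc h, of "w \<stileturn> l"] L(1)[OF w l(1)] l w xi dashv_closed by auto
    moreover have "y \<turnstile> (x \<turnstile> w) = w"
      using R(2)[OF _ yc h, of "x \<turnstile> w"] L(2)[OF _ l(1)] l w x yc xi vdash_closed by metis
    ultimately show ?thesis using R[OF w yc h] by simp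
  next
    assume h: "y \<stileturn> x \<in> Halo D"
    have "(w \<stileturn> x) \<stileturn> y = w"
      using L(1)[OF _ yc h, of "w \<stileturn> x"] R(1)[OF _ r(1)] r w x yc xi dashv_closed by metis
    moreover have "x \<turnstile> (y \<turnstile> w) = w"
      using L(2)[OF _ yc h, of "r \<turnstile> w"] R(2)[OF w r(1)] r w xi vdash_closed by auto
    ultimately show ?thesis using L[OF w yc h] by simp
  qed
  then show "(w \<stileturn> x) \<stileturn> y = w" "(w \<stileturn> y) \<stileturn> x = w" "x \<turnstile> (y \<turnstile> w) = w" "y \<turnstile> (x \<turnstile> w) = w"
    by auto
qed

lemma dashv_one_sided_inverse_unique:
  assumes x: "x \<in> carrier D" and w: "w \<in> carrier D"
    and y: "y \<in> one_sided_inverses D x" and z: "z \<in> one_sided_inverses D x"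
  shows "w \<stileturn> y = w \<stileturn> z"
proof -
  have "w \<stileturn> y \<in> carrier D"
    using w y dashv_closed by (simp add: one_sided_inverses_def)
  from one_sided_inverse_cancel(1)[OF x z this] one_sided_inverse_cancel(2)[OF x y w]
  show ?thesis by simp
qed

end


section \<open>Racks and the conjugation rack\<close>

record 'a rack = "'a partial_object" +
  rack_op :: "'a \<Rightarrow> 'a \<Rightarrow> 'a" (infixr "\<triangleright>\<index>" 70)

definition left_translation :: "('a, 'm) rack_scheme \<Rightarrow> 'a \<Rightarrow> 'a \<Rightarrow> 'a" where
  "left_translation X x = (\<lambda>y. x \<triangleright>\<^bsub>X\<^esub> y)"

locale rack =
  fixes X :: "('a, 'm) rack_scheme" (structure)
  assumes carrier_nonempty: "carrier X \<noteq> {}"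
    and left_translation_bij:
      "x \<in> carrier X \<Longrightarrow> bij_betw (left_translation X x) (carrier X) (carrier X)"
    and self_distributive: "x \<in> carrier X \<Longrightarrow> y \<in> carrier X \<Longrightarrow> z \<in> carrier X \<Longrightarrow>
      x \<triangleright> (y \<triangleright> z) = (x \<triangleright> y) \<triangleright> (x \<triangleright> z)"

text \<open>The choice of the one-sided inverse does not matter, by
  \<open>dashv_one_sided_inverse_unique\<close>.\<close>

definition Conj :: "('a, 'm) digroup_scheme \<Rightarrow> 'a rack" where
  "Conj D = \<lparr>carrier = carrier D,
     rack_op = (\<lambda>x y. (x \<turnstile>\<^bsub>D\<^esub> y) \<stileturn>\<^bsub>D\<^esub> (SOME z. z \<in> one_sided_inverses D x))\<rparr>"

context generalized_digroup
begin

lemma one_sided_inverse_some: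
  assumes "x \<in> carrier D"
  shows "(SOME z. z \<in> one_sided_inverses D x) \<in> one_sided_inverses D x"
proof -
  obtain \<xi> where xi: "\<xi> \<in> Halo D" using Halo_nonempty by auto
  obtain r where "r \<in> carrier D" "x \<turnstile> r = \<xi>"
    using right_inverse_exists[OF xi assms] by blast
  then have "r \<in> one_sided_inverses D x" using xi by (simp add: one_sided_inverses_def)
  then show ?thesis by (rule someI)
qed

lemma Conj_op:
  assumes x: "x \<in> carrier D" and y: "y \<in> carrier D" and z: "z \<in> one_sided_inverses D x"
  shows "x \<triangleright>\<^bsub>Conj D\<^esub> y = (x \<turnstile> y) \<stileturn> z"
  using dashv_one_sided_inverse_unique[OF x vdash_closed[OF x y] one_sided_inverse_some[OF x] z]
  by (simp add: Conj_def)

lemma Conj_rack: "rack (Conj D)"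
proof
  show "carrier (Conj D) \<noteq> {}"
    using Halo_nonempty by (auto simp: Conj_def Halo_def)
next
  fix x assume "x \<in> carrier (Conj D)"
  then have x: "x \<in> carrier D" by (simp add: Conj_def)
  then obtain u where u: "u \<in> one_sided_inverses D x" using one_sided_inverse_some by blast
  then have uc: "u \<in> carrier D" by (simp add: one_sided_inverses_def)
  note c = vdash_closed dashv_closed x uc
  have "bij_betw (left_translation (Conj D) x) (carrier D) (carrier D)"
  proof (rule bij_betw_byWitness[where f' = "\<lambda>y. (u \<turnstile> y) \<stileturn> x"])
    show "\<forall>y\<in>carrier D. u \<turnstile> left_translation (Conj D) x y \<stileturn> x = y"
      using one_sided_inverse_cancel[OF x u]
      by (simp add: left_translation_def Conj_op[OF x _ u] vdash_dashv_assoc[symmetric] c)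
    show "\<forall>y\<in>carrier D. left_translation (Conj D) x (u \<turnstile> y \<stileturn> x) = y"
      using one_sided_inverse_cancel[OF x u]
      by (simp add: left_translation_def Conj_op[OF x _ u] vdash_dashv_assoc[symmetric] c)
  qed (auto simp: left_translation_def Conj_op[OF x _ u] c)
  then show "bij_betw (left_translation (Conj D) x) (carrier (Conj D)) (carrier (Conj D))"
    by (simp add: Conj_def)
next
  fix x y z assume "x \<in> carrier (Conj D)" "y \<in> carrier (Conj D)" "z \<in> carrier (Conj D)"
  then have x: "x \<in> carrier D" and y: "y \<in> carrier D" and z: "z \<in> carrier D"
    by (simp_all add: Conj_def)
  obtain u where u: "u \<in> one_sided_inverses D x" using one_sided_inverse_some x by blast
  then have uc: "u \<in> carrier D" by (simp add: one_sided_inverses_def)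
  obtain v where v: "v \<in> one_sided_inverses D y" using one_sided_inverse_some y by blast
  then have vc: "v \<in> carrier D" by (simp add: one_sided_inverses_def)
  note c = vdash_closed dashv_closed x y z uc vc
  define p where "p = (x \<turnstile> y) \<stileturn> u"
  have pc: "p \<in> carrier D" by (simp add: p_def c)
  obtain q where q: "q \<in> one_sided_inverses D p" using one_sided_inverse_some pc by blast
  then have qc: "q \<in> carrier D" by (simp add: one_sided_inverses_def)
  have R: "w \<stileturn> p = ((w \<stileturn> x) \<stileturn> y) \<stileturn> u" if "w \<in> carrier D" for w
    using that by (simp add: p_def dashv_assoc dashv_inner c)
  have L: "p \<turnstile> w = x \<turnstile> (y \<turnstile> (u \<turnstile> w))" if "w \<in> carrier D" for w
    using that by (simp add: p_def vdash_assoc c flip: vdash_inner)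
  have Q: "w \<stileturn> q = ((w \<stileturn> x) \<stileturn> v) \<stileturn> u" if "w \<in> carrier D" for w
  proof -
    have "(((w \<stileturn> x) \<stileturn> v) \<stileturn> u) \<stileturn> p = w"
      using that one_sided_inverse_cancel[OF x u] one_sided_inverse_cancel[OF y v]
      by (simp add: R c)
    then show ?thesis
      using one_sided_inverse_cancel(1)[OF pc q, of "((w \<stileturn> x) \<stileturn> v) \<stileturn> u"] that c by simp
  qed
  have "(x \<triangleright>\<^bsub>Conj D\<^esub> y) \<triangleright>\<^bsub>Conj D\<^esub> (x \<triangleright>\<^bsub>Conj D\<^esub> z) = (p \<turnstile> ((x \<turnstile> z) \<stileturn> u)) \<stileturn> q"
    by (simp add: Conj_op[OF x _ u] Conj_op[OF pc _ q] c flip: p_def)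
  also have "\<dots> = x \<turnstile> (y \<turnstile> (u \<turnstile> (((((x \<turnstile> z) \<stileturn> u) \<stileturn> x) \<stileturn> v) \<stileturn> u)))"
    by (simp add: Q L c vdash_dashv_assoc pc)
  also have "\<dots> = x \<turnstile> (y \<turnstile> (u \<turnstile> (((x \<turnstile> z) \<stileturn> v) \<stileturn> u)))"
    using one_sided_inverse_cancel[OF x u] c by simp
  also have "\<dots> = x \<turnstile> (y \<turnstile> ((z \<stileturn> v) \<stileturn> u))"
    using one_sided_inverse_cancel(4)[OF x u, of "(z \<stileturn> v) \<stileturn> u"]
    by (simp add: vdash_dashv_assoc c)
  also have "\<dots> = x \<triangleright>\<^bsub>Conj D\<^esub> (y \<triangleright>\<^bsub>Conj D\<^esub> z)"
    by (simp add: Conj_op[OF x _ u] Conj_op[OF y _ v] vdash_dashv_assoc c)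
  finally show "x \<triangleright>\<^bsub>Conj D\<^esub> (y \<triangleright>\<^bsub>Conj D\<^esub> z) =
      (x \<triangleright>\<^bsub>Conj D\<^esub> y) \<triangleright>\<^bsub>Conj D\<^esub> (x \<triangleright>\<^bsub>Conj D\<^esub> z)" ..
qed

end


section \<open>The structure isomorphism\<close>

definition left_group :: "('a, 'm) digroup_scheme \<Rightarrow> 'a \<Rightarrow> 'a monoid" where
  "left_group D \<xi> =
    \<lparr>carrier = {\<xi> \<stileturn>\<^bsub>D\<^esub> x |x. x \<in> carrier D}, monoid.mult = (\<stileturn>\<^bsub>D\<^esub>), one = \<xi>\<rparr>"

definition halo_action :: "('a, 'm) digroup_scheme \<Rightarrow> 'a \<Rightarrow> 'a \<Rightarrow> 'a \<Rightarrow> 'a" where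
  "halo_action D \<xi> g = (\<lambda>\<alpha>. (g \<turnstile>\<^bsub>D\<^esub> \<alpha>) \<stileturn>\<^bsub>D\<^esub> inv\<^bsub>left_group D \<xi>\<^esub> g)"

definition group_conj :: "('a, 'm) monoid_scheme \<Rightarrow> 'a \<Rightarrow> 'a \<Rightarrow> 'a" where
  "group_conj G g = (\<lambda>h. g \<otimes>\<^bsub>G\<^esub> h \<otimes>\<^bsub>G\<^esub> inv\<^bsub>G\<^esub> g)"

definition structure_iso :: "('a, 'm) digroup_scheme \<Rightarrow> 'a \<Rightarrow> 'a \<Rightarrow> 'a \<times> 'a" where
  "structure_iso D \<xi> x =
    (\<xi> \<stileturn>\<^bsub>D\<^esub> x, x \<stileturn>\<^bsub>D\<^esub> (SOME z. z \<in> carrier D \<and> z \<stileturn>\<^bsub>D\<^esub> x = \<xi>))"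

definition halo_product :: "('a, 'm) digroup_scheme \<Rightarrow> 'a \<Rightarrow> ('a \<times> 'a) digroup" where
  "halo_product D \<xi> = \<lparr>carrier = carrier (left_group D \<xi>) \<times> Halo D,
     vdash = (\<lambda>(g, \<alpha>) (h, \<beta>). (g \<otimes>\<^bsub>left_group D \<xi>\<^esub> h, halo_action D \<xi> g \<beta>)),
     dashv = (\<lambda>(g, \<alpha>) (h, \<beta>). (g \<otimes>\<^bsub>left_group D \<xi>\<^esub> h, \<alpha>))\<rparr>"

context generalized_digroup
begin

lemma left_group_group:
  assumes xi: "\<xi> \<in> Halo D"
  shows "group (left_group D \<xi>)"
proof (rule groupI)
  note xc = HaloD(1)[OF xi]
  note c = vdash_closed dashv_closed xc
  fix g h k
  assume "g \<in> carrier (left_group D \<xi>)"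
  then obtain x where x: "x \<in> carrier D" "g = \<xi> \<stileturn> x" by (auto simp: left_group_def)
  show "\<one>\<^bsub>left_group D \<xi>\<^esub> \<otimes>\<^bsub>left_group D \<xi>\<^esub> g = g"
    using x xi c by (simp add: left_group_def HaloD flip: dashv_assoc)
  obtain l where l: "l \<in> carrier D" "l \<stileturn> x = \<xi>" using left_inverse_exists xi x by blast
  have "(\<xi> \<stileturn> l) \<stileturn> g = \<xi>"
    using x l c xi HaloD(2)[OF xi] by (metis dashv_assoc)
  then show "\<exists>y\<in>carrier (left_group D \<xi>). y \<otimes>\<^bsub>left_group D \<xi>\<^esub> g = \<one>\<^bsub>left_group D \<xi>\<^esub>"
    using l by (auto simp: left_group_def)
  assume "h \<in> carrier (left_group D \<xi>)"
  then obtain y where y: "y \<in> carrier D" "h = \<xi> \<stileturn> y" by (auto simp: left_group_def)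
  show "g \<otimes>\<^bsub>left_group D \<xi>\<^esub> h \<in> carrier (left_group D \<xi>)"
    using x y c dashv_assoc[OF xc x(1), of "\<xi> \<stileturn> y"]
    by (auto simp: left_group_def intro!: exI[of _ "x \<stileturn> (\<xi> \<stileturn> y)"])
  assume "k \<in> carrier (left_group D \<xi>)"
  then obtain z where z: "z \<in> carrier D" "k = \<xi> \<stileturn> z" by (auto simp: left_group_def)
  show "g \<otimes>\<^bsub>left_group D \<xi>\<^esub> h \<otimes>\<^bsub>left_group D \<xi>\<^esub> k =
      g \<otimes>\<^bsub>left_group D \<xi>\<^esub> (h \<otimes>\<^bsub>left_group D \<xi>\<^esub> k)"
    using x y z c by (simp add: left_group_def dashv_assoc)
next
  show "\<one>\<^bsub>left_group D \<xi>\<^esub> \<in> carrier (left_group D \<xi>)"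
    using HaloD[OF xi] by (force simp: left_group_def)
qed

lemma structure_iso_snd:
  assumes xi: "\<xi> \<in> Halo D" and x: "x \<in> carrier D" and y: "y \<in> one_sided_inverses D x"
  shows "snd (structure_iso D \<xi> x) = x \<stileturn> y"
proof -
  let ?l = "SOME z. z \<in> carrier D \<and> z \<stileturn> x = \<xi>"
  have "?l \<in> carrier D \<and> ?l \<stileturn> x = \<xi>"
    using left_inverse_exists[OF xi x] by (metis (mono_tags, lifting) someI_ex)
  then have "?l \<in> one_sided_inverses D x" using xi by (simp add: one_sided_inverses_def)
  then show ?thesis
    using dashv_one_sided_inverse_unique[OF x x _ y] by (simp add: structure_iso_def)
qed

lemma dashv_inverse_in_Halo:
  assumes x: "x \<in> carrier D" and y: "y \<in> one_sided_inverses D x"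
  shows "x \<stileturn> y \<in> Halo D"
proof -
  have yc: "y \<in> carrier D" using y by (simp add: one_sided_inverses_def)
  have "w \<stileturn> (x \<stileturn> y) = w" if "w \<in> carrier D" for w
    using that x yc one_sided_inverse_cancel(1)[OF x y that] by (simp add: dashv_assoc)
  moreover have "(x \<stileturn> y) \<turnstile> w = w" if "w \<in> carrier D" for w
    using vdash_inner[OF x yc that] vdash_assoc[OF x yc that]
      one_sided_inverse_cancel(3)[OF x y that] by simp
  ultimately show ?thesis using x yc dashv_closed by (simp add: Halo_def)
qed

lemma structure_iso_bij:
  assumes xi: "\<xi> \<in> Halo D"
  shows "bij_betw (structure_iso D \<xi>) (carrier D) (carrier (halo_product D \<xi>))"
proof (rule bij_betw_byWitness[where f' = "\<lambda>(g, \<alpha>). \<alpha> \<stileturn> g"])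
  note xc = HaloD(1)[OF xi]
  note c = vdash_closed dashv_closed xc
  have fst: "fst (structure_iso D \<xi> x) = \<xi> \<stileturn> x" for x by (simp add: structure_iso_def)
  show "\<forall>x\<in>carrier D. (case structure_iso D \<xi> x of (g, \<alpha>) \<Rightarrow> \<alpha> \<stileturn> g) = x"
  proof
    fix x assume x: "x \<in> carrier D"
    obtain y where y: "y \<in> one_sided_inverses D x" using one_sided_inverse_some x by blast
    then have yc: "y \<in> carrier D" by (simp add: one_sided_inverses_def)
    have "(x \<stileturn> y) \<stileturn> (\<xi> \<stileturn> x) = x"
      using one_sided_inverse_cancel(2)[OF x y x] HaloD(2)[OF xi] x yc xc dashv_closed
      by (simp flip: dashv_assoc)
    then show "(case structure_iso D \<xi> x of (g, \<alpha>) \<Rightarrow> \<alpha> \<stileturn> g) = x"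
      using structure_iso_snd[OF xi x y] fst[of x] by (simp add: case_prod_beta)
  qed
  show "structure_iso D \<xi> ` carrier D \<subseteq> carrier (halo_product D \<xi>)"
  proof
    fix p assume "p \<in> structure_iso D \<xi> ` carrier D"
    then obtain x where x: "x \<in> carrier D" "p = structure_iso D \<xi> x" by auto
    obtain y where y: "y \<in> one_sided_inverses D x" using one_sided_inverse_some x by blast
    show "p \<in> carrier (halo_product D \<xi>)"
      using x fst[of x] structure_iso_snd[OF xi x(1) y] dashv_inverse_in_Halo[OF x(1) y]
      by (auto simp: halo_product_def left_group_def mem_Times_iff)
  qed
  have *: "\<alpha> \<stileturn> g \<in> carrier D \<and> structure_iso D \<xi> (\<alpha> \<stileturn> g) = (g, \<alpha>)"
    if g: "g \<in> carrier (left_group D \<xi>)" and a: "\<alpha> \<in> Halo D" for g \<alpha>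
  proof -
    note ac = HaloD(1)[OF a]
    obtain x where x: "x \<in> carrier D" "g = \<xi> \<stileturn> x" using g by (auto simp: left_group_def)
    have gc: "g \<in> carrier D" using x c by simp
    have agc: "\<alpha> \<stileturn> g \<in> carrier D" using ac gc c by simp
    have 1: "\<xi> \<stileturn> (\<alpha> \<stileturn> g) = g"
      using x ac gc xc HaloD(2)[OF a] HaloD(2)[OF xi] c
      by (simp flip: dashv_assoc)
    obtain y where y: "y \<in> one_sided_inverses D (\<alpha> \<stileturn> g)"
      using one_sided_inverse_some agc by blast
    have "(\<alpha> \<stileturn> g) \<stileturn> y = \<alpha>"
    proof -
      have "(\<alpha> \<stileturn> (\<alpha> \<stileturn> g)) \<stileturn> y = \<alpha>"
        using one_sided_inverse_cancel(1)[OF agc y ac] .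
      then show ?thesis using ac gc HaloD(2)[OF a ac] by (simp flip: dashv_assoc)
    qed
    then show ?thesis
      using 1 agc structure_iso_snd[OF xi agc y] fst[of "\<alpha> \<stileturn> g"] by (simp add: prod_eq_iff)
  qed
  show "\<forall>p\<in>carrier (halo_product D \<xi>). structure_iso D \<xi> (case p of (g, \<alpha>) \<Rightarrow> \<alpha> \<stileturn> g) = p"
    using * by (auto simp: halo_product_def)
  show "(\<lambda>(g, \<alpha>). \<alpha> \<stileturn> g) ` carrier (halo_product D \<xi>) \<subseteq> carrier D"
    using * by (auto simp: halo_product_def)
qed

lemma structure_iso_hom:
  assumes xi: "\<xi> \<in> Halo D" and x: "x \<in> carrier D" and y: "y \<in> carrier D"
  shows "structure_iso D \<xi> (x \<turnstile> y) = structure_iso D \<xi> x \<turnstile>\<^bsub>halo_product D \<xi>\<^esub> structure_iso D \<xi> y"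
    and "structure_iso D \<xi> (x \<stileturn> y) = structure_iso D \<xi> x \<stileturn>\<^bsub>halo_product D \<xi>\<^esub> structure_iso D \<xi> y"
proof -
  note xc = HaloD(1)[OF xi]
  obtain u where u: "u \<in> one_sided_inverses D x" using one_sided_inverse_some x by blast
  then have uc: "u \<in> carrier D" by (simp add: one_sided_inverses_def)
  obtain v where v: "v \<in> one_sided_inverses D y" using one_sided_inverse_some y by blast
  then have vc: "v \<in> carrier D" by (simp add: one_sided_inverses_def)
  note c = vdash_closed dashv_closed x y uc vc xc
  have X: "structure_iso D \<xi> x = (\<xi> \<stileturn> x, x \<stileturn> u)"
    using structure_iso_snd[OF xi x u] by (simp add: structure_iso_def)
  have Y: "structure_iso D \<xi> y = (\<xi> \<stileturn> y, y \<stileturn> v)"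
    using structure_iso_snd[OF xi y v] by (simp add: structure_iso_def)
  have inverse_R: "w \<stileturn> q = (w \<stileturn> v) \<stileturn> u"
    if p: "p = x \<turnstile> y \<or> p = x \<stileturn> y" and q: "q \<in> one_sided_inverses D p" and w: "w \<in> carrier D"
    for p q w
  proof -
    have pc: "p \<in> carrier D" using p c by auto
    have "((w \<stileturn> v) \<stileturn> u) \<stileturn> p = ((((w \<stileturn> v) \<stileturn> u) \<stileturn> x) \<stileturn> y)"
      using p w c by (auto simp: dashv_assoc simp flip: dashv_inner)
    also have "\<dots> = w"
      using w c one_sided_inverse_cancel(2)[OF x u] one_sided_inverse_cancel(2)[OF y v] by simp
    finally show ?thesis
      using one_sided_inverse_cancel(1)[OF pc q, of "(w \<stileturn> v) \<stileturn> u"] w c by simp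
  qed
  have fst: "(\<xi> \<stileturn> x) \<stileturn> (\<xi> \<stileturn> y) = \<xi> \<stileturn> (x \<stileturn> y)"
    using c HaloD(2)[OF xi] by (simp flip: dashv_assoc)
  obtain q where q: "q \<in> one_sided_inverses D (x \<stileturn> y)"
    using one_sided_inverse_some c by blast
  have "snd (structure_iso D \<xi> (x \<stileturn> y)) = ((x \<stileturn> y) \<stileturn> v) \<stileturn> u"
    using structure_iso_snd[OF xi _ q] inverse_R[OF _ q] c by simp
  also have "\<dots> = x \<stileturn> u"
    using one_sided_inverse_cancel(1)[OF y v x] by simp
  finally show "structure_iso D \<xi> (x \<stileturn> y) =
      structure_iso D \<xi> x \<stileturn>\<^bsub>halo_product D \<xi>\<^esub> structure_iso D \<xi> y"
    by (simp add: X Y halo_product_def left_group_def fst prod_eq_iff)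
      (simp add: structure_iso_def)
  let ?G = "left_group D \<xi>"
  let ?g = "\<xi> \<stileturn> x"
  have G: "group ?G" using left_group_group[OF xi] .
  have gG: "?g \<in> carrier ?G" using x by (auto simp: left_group_def)
  have iG: "inv\<^bsub>?G\<^esub> ?g \<in> carrier ?G" using group.inv_closed[OF G gG] .
  then have ic: "inv\<^bsub>?G\<^esub> ?g \<in> carrier D" using c by (auto simp: left_group_def)
  have ginv: "(inv\<^bsub>?G\<^esub> ?g) \<stileturn> ?g = \<xi>"
    using group.l_inv[OF G gG] by (simp add: left_group_def)
  have iu: "w \<stileturn> inv\<^bsub>?G\<^esub> ?g = w \<stileturn> u" if "w \<in> carrier D" for w
  proof -
    have "(inv\<^bsub>?G\<^esub> ?g) \<stileturn> x = \<xi>"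
      using ginv ic c HaloD(2)[OF xi] by (simp flip: dashv_assoc)
    then have "inv\<^bsub>?G\<^esub> ?g \<in> one_sided_inverses D x"
      using ic xi by (simp add: one_sided_inverses_def)
    then show ?thesis using dashv_one_sided_inverse_unique[OF x that _ u] by blast
  qed
  have act: "halo_action D \<xi> ?g (y \<stileturn> v) = ((x \<turnstile> y) \<stileturn> v) \<stileturn> u"
    using c HaloD(3)[OF xi]
    by (simp add: halo_action_def iu vdash_dashv_assoc vdash_assoc flip: vdash_inner)
  obtain q where q: "q \<in> one_sided_inverses D (x \<turnstile> y)"
    using one_sided_inverse_some c by blast
  have "snd (structure_iso D \<xi> (x \<turnstile> y)) = ((x \<turnstile> y) \<stileturn> v) \<stileturn> u"
    using structure_iso_snd[OF xi _ q] inverse_R[OF _ q] c by simp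
  then show "structure_iso D \<xi> (x \<turnstile> y) =
      structure_iso D \<xi> x \<turnstile>\<^bsub>halo_product D \<xi>\<^esub> structure_iso D \<xi> y"
    using dashv_inner[OF xc x y]
    by (simp add: X Y halo_product_def act prod_eq_iff)
      (simp add: structure_iso_def left_group_def fst)
qed

end


section \<open>Cycle counts and the left-translation cycle index\<close>

text \<open>For a function \<open>f\<close> that permutes the finite set \<open>X\<close>, the sets \<open>C \<subseteq> X\<close> with
  \<open>cyclic_on f C\<close> are the supports of the cycles of \<open>f\<close> on \<open>X\<close>, fixed points included.
  The values of \<open>f\<close> outside \<open>X\<close> play no role.\<close>

definition cycle_count :: "'a set \<Rightarrow> ('a \<Rightarrow> 'a) \<Rightarrow> nat \<Rightarrow> nat" where
  "cycle_count X f l = card {C. C \<subseteq> X \<and> cyclic_on f C \<and> card C = l}"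

text \<open>Polynomials over the rationals in the variables \<open>u\<^sub>1, u\<^sub>2, \<dots>\<close>: finitely supported maps from
  monomials to coefficients, a monomial being a finitely supported map from variable indices to
  exponents. Multiplication is convolution.\<close>

type_synonym cycle_poly = "(nat \<Rightarrow>\<^sub>0 nat) \<Rightarrow>\<^sub>0 rat"

definition const_poly :: "rat \<Rightarrow> cycle_poly" where
  "const_poly r = Poly_Mapping.single 0 r"

definition u_var :: "nat \<Rightarrow> cycle_poly" where
  "u_var l = Poly_Mapping.single (Poly_Mapping.single l 1) 1"

text \<open>The product over all \<open>l \<ge> 1\<close> of \<open>u_var l ^ c l\<close>; it is meant for \<open>c\<close> of finite support on
  \<open>{1..}\<close>, and the factors left out are equal to \<open>1\<close>.\<close>

definition u_monomial :: "(nat \<Rightarrow> nat) \<Rightarrow> cycle_poly" where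
  "u_monomial c = (\<Prod>l | 1 \<le> l \<and> c l \<noteq> 0. u_var l ^ c l)"

definition LT_cycle_index :: "('a, 'm) rack_scheme \<Rightarrow> cycle_poly" where
  "LT_cycle_index X = const_poly (1 / of_nat (card (carrier X))) *
     (\<Sum>x\<in>carrier X. u_monomial (cycle_count (carrier X) (left_translation X x)))"

end

theory Submission
  imports Defs
begin

text \<open>Under the structure isomorphism the left translation by \<open>(g, \<alpha>)\<close> becomes the product map
  \<open>(h, \<beta>) \<mapsto> (g h g\<^sup>-\<^sup>1, g \<bullet> \<beta>)\<close>, which does not depend on \<open>\<alpha>\<close>. The orbit of a pair under a product map
  has the lcm of the two orbit lengths as its length, so counting the points on cycles of
  length \<open>l\<close> gives
  \<open>l c\<^sub>l = \<Sum> (i a\<^sub>i) (j b\<^sub>j)\<close>, summed over \<open>lcm i j = l\<close>, and \<open>i j = l gcd i j\<close>.\<close>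

section \<open>Orbit lengths and cycle counts\<close>

text \<open>With \<open>p\<close> the least positive return time of \<open>x\<close>, the first
  \<open>p\<close> iterates are distinct and exhaust the orbit, and \<open>n\<close> only matters
  modulo \<open>p\<close>. Orbit lengths thus become divisibility conditions, which is how the lcm
  will enter.\<close>

lemma funpow_fixed_iff_card_orbit_dvd:
  assumes "x \<in> orbit f x"
  shows "(f ^^ n) x = x \<longleftrightarrow> card (orbit f x) dvd n"
proof -
  define p where "p = (LEAST n. 0 < n \<and> (f ^^ n) x = x)"
  have ex: "\<exists>n. 0 < n \<and> (f ^^ n) x = x"
    using assms by (auto simp: orbit_altdef)
  have p: "0 < p" "(f ^^ p) x = x"
    using LeastI_ex[OF ex] by (auto simp: p_def)
  have least: "p \<le> n" if "0 < n" "(f ^^ n) x = x" for n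
    using that by (auto simp: p_def intro: Least_le)
  have neq: "(f ^^ i) x \<noteq> (f ^^ j) x" if "i < j" "j < p" for i j
  proof
    assume "(f ^^ i) x = (f ^^ j) x"
    \<comment> \<open>A further \<open>p - j\<close> steps bring the right side back to
      \<open>x\<close>, so \<open>x\<close> returns after \<open>p - j + i\<close> steps, a positive
      number below \<open>p\<close>.\<close>
    then have "(f ^^ (p - j + i)) x = (f ^^ (p - j + j)) x"
      unfolding funpow_add by simp
    then show False
      using least[of "p - j + i"] p that by simp
  qed
  have "inj_on (\<lambda>m. (f ^^ m) x) {..<p}"
    using neq by (intro inj_onI) (metis lessThan_iff linorder_neqE_nat)
  moreover have "orbit f x = (\<lambda>m. (f ^^ m) x) ` {..<p}"
    using orbit_altdef_bounded[OF p(2,1)] by auto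
  ultimately have card: "card (orbit f x) = p"
    by (simp add: card_image)
  have "(f ^^ n) x = x \<longleftrightarrow> n mod p = 0"
    using funpow_mod_eq[OF p(2), of n] least[of "n mod p"] p(1)
    by (metis funpow_0 mod_less_divisor neq0_conv not_le)
  then show ?thesis
    by (simp add: card dvd_eq_mod_eq_0)
qed

lemma orbit_subset_invariant:
  assumes "x \<in> X" and "f \<in> X \<rightarrow> X"
  shows "orbit f x \<subseteq> X"
proof
  fix y assume "y \<in> orbit f x"
  then show "y \<in> X" by induction (use assms in auto)
qed

text \<open>The orbit never leaves \<open>X\<close>, so \<open>f\<close> may be replaced by
  \<open>p\<close>, its modification to the identity outside \<open>X\<close>. This is a genuine
  permutation of finite support.\<close>

lemma self_in_orbit_if_bij_betw:
  assumes "bij_betw f X X" and "finite X" and "x \<in> X"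
  shows "x \<in> orbit f x"
proof -
  define p where "p y = (if y \<in> X then f y else y)" for y
  have "bij_betw p X X"
    using assms(1) by (subst bij_betw_cong[where g = f]) (auto simp: p_def)
  then have "p permutes X"
    by (rule bij_imp_permutes) (simp add: p_def)
  then have "x \<in> orbit p x"
    using assms(2) by (intro permutation_self_in_orbit) (auto simp: permutation_permutes)
  moreover have "orbit f x = orbit p x"
    using assms by (intro orbit_cong0[where A = X]) (auto simp: p_def bij_betw_def)
  ultimately show ?thesis by simp
qed

text \<open>The supports of the \<open>l\<close>-cycles are disjoint, have \<open>l\<close> elements
  each, and together contain exactly the points counted on the left.\<close>

lemma card_orbit_length_eq:
  assumes "bij_betw f X X" and "finite X"
  shows "card {x \<in> X. card (orbit f x) = l} = l * cycle_count X f l"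
proof -
  let ?C = "{C. C \<subseteq> X \<and> cyclic_on f C \<and> card C = l}"
  have self: "x \<in> orbit f x" and sub: "orbit f x \<subseteq> X" if "x \<in> X" for x
    using self_in_orbit_if_bij_betw[OF assms that] orbit_subset_invariant[OF that] assms(1)
    by (auto simp: bij_betw_def)
  have "{x \<in> X. card (orbit f x) = l} = \<Union>?C"
  proof (intro equalityI subsetI)
    fix x assume "x \<in> {x \<in> X. card (orbit f x) = l}"
    then show "x \<in> \<Union>?C"
      using self[of x] sub[of x] by (auto intro!: exI[of _ "orbit f x"] simp: cyclic_on_def)
  next
    fix x assume "x \<in> \<Union>?C"
    then show "x \<in> {x \<in> X. card (orbit f x) = l}"
      by (auto simp: orbit_cyclic_eq3)
  qed
  moreover have "l * card ?C = card (\<Union>?C)"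
  proof (rule card_partition)
    show "finite ?C" "finite (\<Union>?C)"
      using assms(2) by (auto intro: finite_subset[of _ X] finite_subset[of _ "Pow X"])
    show "c1 \<inter> c2 = {}" if "c1 \<in> ?C" "c2 \<in> ?C" "c1 \<noteq> c2" for c1 c2
      using that by (auto simp: cyclic_on_alldef)
  qed auto
  ultimately show ?thesis by (simp add: cycle_count_def)
qed

text \<open>The conjugating map carries orbits onto orbits, so equally many points have orbit length
  \<open>l\<close>; as \<open>l\<close> is positive, it cancels from both point counts.\<close>

lemma cycle_count_conjugate:
  assumes f: "bij_betw f X X" and g: "bij_betw g Y Y" and X: "finite X"
    and \<phi>: "bij_betw \<phi> X Y" and comm: "\<And>x. x \<in> X \<Longrightarrow> \<phi> (f x) = g (\<phi> x)" and l: "1 \<le> l"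
  shows "cycle_count X f l = cycle_count Y g l"
proof -
  have Y: "finite Y" using \<phi> X by (simp add: bij_betw_finite)
  have inj: "inj_on \<phi> X" and im: "\<phi> ` X = Y" using \<phi> by (auto simp: bij_betw_def)
  have orbit: "card (orbit g (\<phi> x)) = card (orbit f x)" if x: "x \<in> X" for x
  proof -
    have sub: "orbit f x \<subseteq> X"
      using orbit_subset_invariant[OF x] f by (auto simp: bij_betw_def)
    have "\<phi> ` orbit f x = orbit g (\<phi> x)"
      using self_in_orbit_if_bij_betw[OF f X x] sub comm by (intro orbit_inverse) auto
    then show ?thesis
      using card_image[OF inj_on_subset[OF inj sub]] by simp
  qed
  have "{y \<in> Y. card (orbit g y) = l} = \<phi> ` {x \<in> X. card (orbit f x) = l}"
    using orbit im by auto
  then have "card {y \<in> Y. card (orbit g y) = l} = card {x \<in> X. card (orbit f x) = l}"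
    by (simp add: card_image[OF inj_on_subset[OF inj]])
  then show ?thesis
    using l by (simp add: card_orbit_length_eq[OF f X] card_orbit_length_eq[OF g Y])
qed

section \<open>Cycles of product maps\<close>

lemma funpow_map_prod:
  fixes f :: "'a \<Rightarrow> 'a" and h :: "'b \<Rightarrow> 'b"
  shows "(map_prod f h ^^ n) (x, y) = ((f ^^ n) x, (h ^^ n) y)"
  by (induction n) auto

text \<open>A pair returns exactly when both coordinates do, so both sides have the same multiples
  and hence divide each other.\<close>

lemma card_orbit_map_prod:
  assumes "x \<in> orbit f x" and "y \<in> orbit h y" and "(x, y) \<in> orbit (map_prod f h) (x, y)"
  shows "card (orbit (map_prod f h) (x, y)) = lcm (card (orbit f x)) (card (orbit h y))"
proof -
  have "card (orbit (map_prod f h) (x, y)) dvd n \<longleftrightarrow>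
      lcm (card (orbit f x)) (card (orbit h y)) dvd n" for n
    using assms by (simp add: funpow_map_prod flip: funpow_fixed_iff_card_orbit_dvd)
  then show ?thesis by (meson dvd_antisym dvd_refl)
qed

lemma bij_betw_map_prod_self:
  assumes "bij_betw f A A" and "bij_betw h B B"
  shows "bij_betw (map_prod f h) (A \<times> B) (A \<times> B)"
  using assms by (auto simp: bij_betw_def map_prod_inj_on map_prod_surj_on)

lemma finite_lcm_pairs:
  fixes l :: nat
  assumes "1 \<le> l"
  shows "finite {(i, j). 1 \<le> i \<and> 1 \<le> j \<and> lcm i j = l}"
proof (rule finite_subset)
  show "{(i, j). 1 \<le> i \<and> 1 \<le> j \<and> lcm i j = l} \<subseteq> {..l} \<times> {..l}"
    using assms dvd_imp_le[OF dvd_lcm1] dvd_imp_le[OF dvd_lcm2] by fastforce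
qed simp

lemma cycle_count_map_prod:
  assumes f: "bij_betw f A A" and h: "bij_betw h B B" and A: "finite A" and B: "finite B"
    and l: "1 \<le> l"
  shows "cycle_count (A \<times> B) (map_prod f h) l =
    (\<Sum>(i, j) | 1 \<le> i \<and> 1 \<le> j \<and> lcm i j = l. cycle_count A f i * cycle_count B h j * gcd i j)"
proof -
  let ?I = "{(i, j). 1 \<le> i \<and> 1 \<le> j \<and> lcm i j = l}"
  let ?A = "\<lambda>i. {x \<in> A. card (orbit f x) = i}" and ?B = "\<lambda>j. {y \<in> B. card (orbit h y) = j}"
  let ?F = "map_prod f h"
  have F: "bij_betw ?F (A \<times> B) (A \<times> B)" and AB: "finite (A \<times> B)"
    using bij_betw_map_prod_self[OF f h] A B by auto
  have orbit: "card (orbit ?F (x, y)) = lcm (card (orbit f x)) (card (orbit h y))"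
    if "x \<in> A" "y \<in> B" for x y
    using that by (intro card_orbit_map_prod self_in_orbit_if_bij_betw[OF f A]
        self_in_orbit_if_bij_betw[OF h B] self_in_orbit_if_bij_betw[OF F AB]) auto
  \<comment> \<open>A zero argument would make the lcm zero, so the bounds in \<open>?I\<close>
    exclude no orbit lengths.\<close>
  have pos: "1 \<le> i \<and> 1 \<le> j" if "lcm i j = l" for i j
    using that l by (cases "i = 0"; cases "j = 0") auto
  have "{p \<in> A \<times> B. card (orbit ?F p) = l} = (\<Union>(i, j)\<in>?I. ?A i \<times> ?B j)"
    using orbit pos by auto
  then have "l * cycle_count (A \<times> B) ?F l = card (\<Union>(i, j)\<in>?I. ?A i \<times> ?B j)"
    by (simp flip: card_orbit_length_eq[OF F AB])
  also have "\<dots> = (\<Sum>(i, j)\<in>?I. card (?A i \<times> ?B j))"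
    using A B finite_lcm_pairs[OF l] by (subst card_UN_disjoint) (auto simp: case_prod_beta)
  \<comment> \<open>The factor \<open>l\<close> is extracted from every term so that it can be
    cancelled at the end.\<close>
  also have "\<dots> = (\<Sum>(i, j)\<in>?I. l * (cycle_count A f i * cycle_count B h j * gcd i j))"
  proof (rule sum.cong, goal_cases)
    case (2 p)
    then obtain i j where p: "p = (i, j)" "lcm i j = l" by auto
    have "i * j = l * gcd i j" using prod_gcd_lcm_nat[of i j] p(2) by (simp add: mult.commute)
    then have "card (?A i \<times> ?B j) = (l * gcd i j) * (cycle_count A f i * cycle_count B h j)"
      unfolding card_cartesian_product card_orbit_length_eq[OF f A] card_orbit_length_eq[OF h B]
      by (metis mult.assoc mult.left_commute)
    then show ?case using p(1) by (simp add: ac_simps)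
  qed simp
  also have "\<dots> = l * (\<Sum>(i, j)\<in>?I. cycle_count A f i * cycle_count B h j * gcd i j)"
    by (simp add: sum_distrib_left case_prod_beta)
  finally show ?thesis using l by simp
qed

text \<open>Nonempty factors can be read off from the image of the product, and on finite sets
  surjectivity gives injectivity. This yields that conjugation and the halo action permute their
  sets without a separate check of action laws.\<close>

lemma bij_betw_factors_of_map_prod:
  assumes "bij_betw (map_prod f h) (A \<times> B) (A \<times> B)" and "finite A" and "finite B"
    and "A \<noteq> {}" and "B \<noteq> {}"
  shows "bij_betw f A A" and "bij_betw h B B"
proof -
  have im: "(f ` A) \<times> (h ` B) = A \<times> B"
    using assms(1) by (auto simp: bij_betw_def map_prod_surj_on)
  then have "f ` A = A" "h ` B = B"
    using assms(4,5) by (auto simp: times_eq_iff)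
  then show "bij_betw f A A" "bij_betw h B B"
    using assms(2,3) by (simp_all add: bij_betw_def eq_card_imp_inj_on)
qed

section \<open>Left translations of the conjugation rack\<close>

context generalized_digroup
begin

text \<open>The homomorphism property is applied to \<open>(x \<turnstile> y) \<stileturn> u\<close>
  for a one-sided inverse \<open>u\<close> of \<open>x\<close>. In the product,
  \<open>\<stileturn>\<close> keeps the halo component of its left argument, so \<open>u\<close>
  contributes only its group component.\<close>

lemma structure_iso_left_translation:
  assumes xi: "\<xi> \<in> Halo D" and x: "x \<in> carrier D" and y: "y \<in> carrier D"
    and g: "structure_iso D \<xi> x = (g, \<alpha>)"
  shows "structure_iso D \<xi> (left_translation (Conj D) x y) =
    map_prod (group_conj (left_group D \<xi>) g) (halo_action D \<xi> g) (structure_iso D \<xi> y)"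
proof -
  let ?G = "left_group D \<xi>"
  interpret G: group ?G by (rule left_group_group[OF xi])
  note xc = HaloD(1)[OF xi]
  obtain u where u: "u \<in> one_sided_inverses D x" using one_sided_inverse_some x by blast
  then have uc: "u \<in> carrier D" by (simp add: one_sided_inverses_def)
  have gx: "g = \<xi> \<stileturn> x" using g by (simp add: structure_iso_def)
  have mem: "\<xi> \<stileturn> z \<in> carrier ?G" if "z \<in> carrier D" for z
    using that by (auto simp: left_group_def)
  \<comment> \<open>The inner \<xi> drops out as a right unit for \<open>\<stileturn>\<close>, and
    then \<open>u\<close> cancels \<open>x\<close>.\<close>
  have "g \<otimes>\<^bsub>?G\<^esub> (\<xi> \<stileturn> u) = \<one>\<^bsub>?G\<^esub>"
    using one_sided_inverse_cancel(1)[OF x u xc] HaloD(2)[OF xi] x uc xc dashv_closed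
    by (simp add: left_group_def gx flip: dashv_assoc)
  then have inv: "inv\<^bsub>?G\<^esub> g = \<xi> \<stileturn> u"
    using mem[OF x] mem[OF uc] by (metis G.inv_equality G.inv_comm gx)
  have fst: "structure_iso D \<xi> z = (\<xi> \<stileturn> z, snd (structure_iso D \<xi> z))" for z
    by (simp add: structure_iso_def)
  have "structure_iso D \<xi> (left_translation (Conj D) x y) = structure_iso D \<xi> ((x \<turnstile> y) \<stileturn> u)"
    by (simp add: left_translation_def Conj_op[OF x y u])
  also have "\<dots> = (structure_iso D \<xi> x \<turnstile>\<^bsub>halo_product D \<xi>\<^esub> structure_iso D \<xi> y)
      \<stileturn>\<^bsub>halo_product D \<xi>\<^esub> structure_iso D \<xi> u"
    by (simp add: structure_iso_hom[OF xi] x y uc vdash_closed)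
  also have "\<dots> = map_prod (group_conj ?G g) (halo_action D \<xi> g) (structure_iso D \<xi> y)"
    using fst[of y] fst[of u] g
    by (cases "structure_iso D \<xi> y"; cases "structure_iso D \<xi> u")
      (simp add: halo_product_def group_conj_def inv)
  finally show ?thesis .
qed

lemma carrier_halo_product: "carrier (halo_product D \<xi>) = carrier (left_group D \<xi>) \<times> Halo D"
  by (simp add: halo_product_def)

lemma cycle_count_left_translation:
  assumes fin: "finite (carrier D)" and xi: "\<xi> \<in> Halo D" and x: "x \<in> carrier D"
    and g: "structure_iso D \<xi> x = (g, \<alpha>)" and l: "1 \<le> l"
  shows "cycle_count (carrier (Conj D)) (left_translation (Conj D) x) l =
    (\<Sum>(i, j) | 1 \<le> i \<and> 1 \<le> j \<and> lcm i j = l.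
      cycle_count (carrier (left_group D \<xi>)) (group_conj (left_group D \<xi>) g) i *
      cycle_count (Halo D) (halo_action D \<xi> g) j * gcd i j)"
proof -
  let ?G = "carrier (left_group D \<xi>)"
  let ?F = "map_prod (group_conj (left_group D \<xi>) g) (halo_action D \<xi> g)"
  let ?s = "structure_iso D \<xi>" and ?L = "left_translation (Conj D) x"
  have carrier: "carrier (Conj D) = carrier D" by (simp add: Conj_def)
  have s: "bij_betw ?s (carrier D) (?G \<times> Halo D)"
    using structure_iso_bij[OF xi] by (simp add: carrier_halo_product)
  have L: "bij_betw ?L (carrier D) (carrier D)"
    using rack.left_translation_bij[OF Conj_rack] x by (simp add: carrier)
  have comm: "?s (?L y) = ?F (?s y)" if "y \<in> carrier D" for y
    using structure_iso_left_translation[OF xi x that g] .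
  \<comment> \<open>Bijectivity of \<open>?F\<close> is transported from the rack: \<open>?F\<close>
    after \<open>?s\<close> equals \<open>?s\<close> after \<open>?L\<close>, and \<open>?s\<close>
    is a bijection.\<close>
  have "bij_betw (\<lambda>y. ?F (?s y)) (carrier D) (?G \<times> Halo D)"
    using bij_betw_trans[OF L s] comm by (simp add: comp_def cong: bij_betw_cong)
  then have F: "bij_betw ?F (?G \<times> Halo D) (?G \<times> Halo D)"
    using bij_betw_comp_iff[OF s, of ?F] by (simp add: comp_def)
  have "finite (?G \<times> Halo D)" and "?G \<times> Halo D \<noteq> {}"
    using bij_betw_finite[OF s] fin bij_betw_apply[OF s x] by auto
  then have ne: "?G \<noteq> {}" "Halo D \<noteq> {}" and finite: "finite ?G" "finite (Halo D)"
    by (auto simp: finite_cartesian_product_iff)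
  note bij = bij_betw_factors_of_map_prod[OF F finite ne]
  show ?thesis
    using cycle_count_conjugate[OF L F fin s comm l] cycle_count_map_prod[OF bij finite l]
    by (simp add: carrier)
qed

end

section \<open>Summation to the cycle index\<close>

lemma u_monomial_cong:
  assumes "\<And>l. 1 \<le> l \<Longrightarrow> c l = d l"
  shows "u_monomial c = u_monomial d"
  unfolding u_monomial_def using assms by (intro prod.cong) auto

lemma const_poly_mult: "const_poly r * const_poly s = const_poly (r * s)"
  by (simp add: const_poly_def mult_single)

lemma of_nat_eq_const_poly: "of_nat n = const_poly (of_nat n)"
  by (induction n) (simp_all add: const_poly_def single_add)

text \<open>The identification of a pair with an element of \<open>D\<close> is made explicit by
  \<open>inv_into\<close> applied to \<open>structure_iso\<close>.\<close>

theorem theorem4p3: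
  fixes D :: "('a, 'm) digroup_scheme" and \<xi> :: 'a
  assumes "generalized_digroup D" and "finite (carrier D)" and "\<xi> \<in> Halo D"
  shows "let G = left_group D \<xi>; E = Halo D;
             a = (\<lambda>i g. cycle_count (carrier G) (group_conj G g) i);
             b = (\<lambda>j g. cycle_count E (halo_action D \<xi> g) j);
             N = (\<lambda>g l. \<Sum>(i, j) | 1 \<le> i \<and> 1 \<le> j \<and> lcm i j = l. a i g * b j g * gcd i j)
         in (\<forall>g\<in>carrier G. \<forall>\<alpha>\<in>E. \<forall>l\<ge>1.
               cycle_count (carrier (Conj D))
                 (left_translation (Conj D) (inv_into (carrier D) (structure_iso D \<xi>) (g, \<alpha>))) l
               = N g l) \<and>
            LT_cycle_index (Conj D) =
              const_poly (1 / of_nat (card (carrier G))) *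
                (\<Sum>g\<in>carrier G. u_monomial (N g))"
proof -
  interpret generalized_digroup D by fact
  note fin = assms(2) and xi = assms(3)
  define G where "G = left_group D \<xi>"
  define N where "N g l = (\<Sum>(i, j) | 1 \<le> i \<and> 1 \<le> j \<and> lcm i j = l.
    cycle_count (carrier G) (group_conj G g) i * cycle_count (Halo D) (halo_action D \<xi> g) j *
    gcd i j)" for g l
  let ?L = "left_translation (Conj D)" and ?s = "structure_iso D \<xi>"
  have s: "bij_betw ?s (carrier D) (carrier G \<times> Halo D)"
    using structure_iso_bij[OF xi] by (simp add: carrier_halo_product G_def)
  \<comment> \<open>Only the group component of \<open>x\<close> enters, which later lets the sum
    over the halo collapse.\<close>
  have count: "cycle_count (carrier (Conj D)) (?L x) l = N (fst (?s x)) l"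
    if "x \<in> carrier D" "1 \<le> l" for x l
    using cycle_count_left_translation[OF fin xi that(1) prod.collapse[symmetric] that(2)]
    by (simp add: N_def G_def)
  have "cycle_count (carrier (Conj D)) (?L (inv_into (carrier D) ?s (g, \<alpha>))) l = N g l"
    if "g \<in> carrier G" "\<alpha> \<in> Halo D" "1 \<le> l" for g \<alpha> l
  proof -
    have p: "(g, \<alpha>) \<in> ?s ` carrier D" using s that by (auto simp: bij_betw_def)
    show ?thesis
      using count[OF inv_into_into[OF p] that(3)] f_inv_into_f[OF p] by simp
  qed
  moreover have "LT_cycle_index (Conj D) =
      const_poly (1 / of_nat (card (carrier G))) * (\<Sum>g\<in>carrier G. u_monomial (N g))"
  proof -
    have finE: "finite (Halo D)"
      using fin by (rule finite_subset[rotated]) (auto simp: Halo_def)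
    \<comment> \<open>Needed to cancel the size of the halo in the rational coefficient.\<close>
    then have E: "card (Halo D) \<noteq> 0" using xi by auto
    have card: "card (carrier D) = card (carrier G) * card (Halo D)"
      using bij_betw_same_card[OF s] by (simp add: card_cartesian_product)
    have "(\<Sum>x\<in>carrier D. u_monomial (cycle_count (carrier (Conj D)) (?L x))) =
        (\<Sum>x\<in>carrier D. u_monomial (N (fst (?s x))))"
      using count by (intro sum.cong u_monomial_cong) auto
    also have "\<dots> = (\<Sum>p\<in>carrier G \<times> Halo D. u_monomial (N (fst p)))"
      using s by (rule sum.reindex_bij_betw)
    also have "\<dots> = (\<Sum>g\<in>carrier G. \<Sum>\<alpha>\<in>Halo D. u_monomial (N g))"
      by (simp only: sum.cartesian_product case_prod_unfold)
    \<comment> \<open>The inner sum is constant in \<alpha>. Its factor, rewritten as a constant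
      polynomial, reduces the normalisation from the size of \<open>D\<close> to that of
      \<open>G\<close>.\<close>
    also have "\<dots> = of_nat (card (Halo D)) * (\<Sum>g\<in>carrier G. u_monomial (N g))"
      by (simp add: sum_distrib_left)
    finally have "LT_cycle_index (Conj D) = const_poly (1 / of_nat (card (carrier D))) *
        const_poly (of_nat (card (Halo D))) * (\<Sum>g\<in>carrier G. u_monomial (N g))"
      by (simp add: LT_cycle_index_def Conj_def of_nat_eq_const_poly mult.assoc)
    then show ?thesis
      using E by (simp add: const_poly_mult card)
  qed
  ultimately show ?thesis
    by (simp add: Let_def G_def N_def[abs_def])
qed

end
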